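(* The similarity reductions of the ZK equation $u_{xt}-(uu_x)_x-u_{yy}=0$ by the one-dimensional symmetry algebras $\{\mathbf x_{(1)}\}$, $\{\mathbf y_{(1)}\}$, $\{\mathbf v_0\}$, $\{k_0\mathbf v_0+\mathbf z_{(1)}\}$ ($k_0\in\mathbb R$) are as follows. In each case a smooth function $u$ of the given form is invariant under the given vector field, and it solves the ZK equation if and only if the displayed reduced equation holds. 1. $\{\mathbf x_{(1)}\}$: $u=u(t,y)$; reduced equation $u_{yy}=0$, with solution $u=q_1(t)y+q_2(t)$, $q_1,q_2$ arbitrary functions of $t$. 2. $\{\mathbf y_{(1)}\}$: $u=u(t,x)$; reduced equation $-u_x^2+u_{tx}-uu_{xx}=0$. 3. $\{\mathbf v_0\}$: $u=x\,w(r,z)$, $r=t$, $z=y^2/x$; reduced equation $$w_r-2w_z-(w-zw_z)^2-zw_{rz}-4zw_{zz}-z^2ww_{zz}=0.$$ 4. $\{k_0\mathbf v_0+\mathbf z_{(1)}\}$: $u=x\,w(r,z)$, $r=2k_0t-\ln x$, $z=y^2/x$ (with $x>0$); reduced equation $$2w_z+(-w+w_r+zw_z)^2+2k_0(w_{rr}+zw_{rz})+4zw_{zz}+w\big(-w_r+w_{rr}+z(2w_{rz}+zw_{zz})\big)-2k_0w_r=0.$$ For $k_0=0$, the reduction by $\{\mathbf z_{(1)}\}$ can be given in the simpler form $u=u(x,y)$ with reduced equation $u_x^2+uu_{xx}+u_{yy}=0$.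
   Context: Here $\mathbf v_0=2x\partial_x+y\partial_y+2u\partial_u$, $\mathbf x_{(1)}=\partial_x$, $\mathbf y_{(1)}=\partial_y$, $\mathbf z_{(1)}=\partial_t$, vector fields on $(t,x,y,u)$-space. A function $u(t,x,y)$ is invariant under a vector field if the field is tangent to its graph. Statements are on the domains where the expressions are defined ($x\ne0$ in case 3, $x>0$ in case 4). *)

theory Defs
  imports "HOL-Analysis.Analysis"
begin

text \<open>
  Points of the base space are triples \<open>(t, x, y)\<close>, points of the total space are
  quadruples \<open>(t, x, y, u)\<close>.
\<close>

type_synonym base_point = "real \<times> real \<times> real"
type_synonym total_point = "real \<times> real \<times> real \<times> real"

text \<open>
  \<open>C\<^sup>n\<close> and \<open>C\<^sup>\<infinity>\<close> on a set, meant for open sets (the derivatives are full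
  derivatives at the points of \<open>S\<close>) and finite-dimensional domains.  Continuity of the
  derivative is expressed through all its directional components.
\<close>

primrec Cn_on ::
  "nat \<Rightarrow> 'a::real_normed_vector set \<Rightarrow> ('a \<Rightarrow> 'b::real_normed_vector) \<Rightarrow> bool" where
  "Cn_on 0 S f \<longleftrightarrow> continuous_on S f"
| "Cn_on (Suc n) S f \<longleftrightarrow>
     (\<forall>p\<in>S. f differentiable (at p)) \<and>
     (\<forall>v. Cn_on n S (\<lambda>p. frechet_derivative f (at p) v))"

definition smooth_on ::
  "'a::real_normed_vector set \<Rightarrow> ('a \<Rightarrow> 'b::real_normed_vector) \<Rightarrow> bool" where
  "smooth_on S f \<longleftrightarrow> (\<forall>n. Cn_on n S f)"

definition pd_t :: "(base_point \<Rightarrow> real) \<Rightarrow> base_point \<Rightarrow> real" where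
  "pd_t f = (\<lambda>(t, x, y). deriv (\<lambda>s. f (s, x, y)) t)"

definition pd_x :: "(base_point \<Rightarrow> real) \<Rightarrow> base_point \<Rightarrow> real" where
  "pd_x f = (\<lambda>(t, x, y). deriv (\<lambda>s. f (t, s, y)) x)"

definition pd_y :: "(base_point \<Rightarrow> real) \<Rightarrow> base_point \<Rightarrow> real" where
  "pd_y f = (\<lambda>(t, x, y). deriv (\<lambda>s. f (t, x, s)) y)"

definition pd1 :: "(real \<times> real \<Rightarrow> real) \<Rightarrow> real \<times> real \<Rightarrow> real" where
  "pd1 f = (\<lambda>(a, b). deriv (\<lambda>s. f (s, b)) a)"

definition pd2 :: "(real \<times> real \<Rightarrow> real) \<Rightarrow> real \<times> real \<Rightarrow> real" where
  "pd2 f = (\<lambda>(a, b). deriv (\<lambda>s. f (a, s)) b)"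

definition solves_ZK_on :: "base_point set \<Rightarrow> (base_point \<Rightarrow> real) \<Rightarrow> bool" where
  "solves_ZK_on \<Omega> u \<longleftrightarrow>
     (\<forall>p\<in>\<Omega>. pd_t (pd_x u) p - pd_x (\<lambda>q. u q * pd_x u q) p - pd_y (pd_y u) p = 0)"

definition v0 :: "total_point \<Rightarrow> total_point" where
  "v0 = (\<lambda>(t, x, y, u). (0, 2 * x, y, 2 * u))"

definition x1 :: "total_point \<Rightarrow> total_point" where
  "x1 = (\<lambda>_. (0, 1, 0, 0))"

definition y1 :: "total_point \<Rightarrow> total_point" where
  "y1 = (\<lambda>_. (0, 0, 1, 0))"

definition z1 :: "total_point \<Rightarrow> total_point" where
  "z1 = (\<lambda>_. (1, 0, 0, 0))"

definition graph_map :: "(base_point \<Rightarrow> real) \<Rightarrow> base_point \<Rightarrow> total_point" where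
  "graph_map u = (\<lambda>(t, x, y). (t, x, y, u (t, x, y)))"

text \<open>
  The tangent space of the graph of \<open>u\<close> at the point over \<open>p\<close> is the range of the
  derivative of its parametrization \<open>graph_map u\<close> at \<open>p\<close>.
\<close>

definition invariant_on ::
  "base_point set \<Rightarrow> (total_point \<Rightarrow> total_point) \<Rightarrow> (base_point \<Rightarrow> real) \<Rightarrow> bool" where
  "invariant_on \<Omega> X u \<longleftrightarrow>
     (\<forall>p\<in>\<Omega>. X (graph_map u p) \<in> range (frechet_derivative (graph_map u) (at p)))"

end

theory Submission
  imports Defs
begin

text \<open>
  A vector field is tangent to the graph of \<open>u\<close> exactly when its \<open>u\<close>-component is the
  derivative of \<open>u\<close> along its horizontal part.  Since \<open>\<Omega>\<close> is open, every derivative of \<open>u\<close>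
  at a point of \<open>\<Omega>\<close> can be computed from the ansatz by the chain rule, so both invariance and
  the reduced equation become polynomial identities in the derivatives of \<open>w\<close>, after clearing
  \<open>x\<close> and using the symmetry of the mixed second derivatives of \<open>w\<close>.  The coefficients of a
  solution affine in \<open>y\<close> are \<open>w\<^sub>y\<close> and \<open>w - y w\<^sub>y\<close>, which on an open set of \<open>t\<close> can be read
  off at a fixed \<open>y\<close>; this makes them smooth.
\<close>

section \<open>Smooth functions\<close>

text \<open>On an open set a full derivative depends only on values near the point, so
  \<open>f\<close> and \<open>g\<close> have the same derivatives on \<open>S\<close>. The induction
  then passes to the directional components of those derivatives.\<close>

lemma Cn_on_cong:
  assumes "open S" "Cn_on n S f" "\<And>p. p \<in> S \<Longrightarrow> f p = g p"
  shows "Cn_on n S g"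
  using assms(2,3)
proof (induction n arbitrary: f g)
  case 0
  then show ?case using continuous_on_cong by force
next
  case (Suc n)
  have ev: "(g has_derivative D) (at p)" if "(f has_derivative D) (at p)" "p \<in> S" for p D
    using has_derivative_transform_within_open[OF that(1) \<open>open S\<close> that(2)] Suc.prems(2) by blast
  have der: "(g has_derivative frechet_derivative f (at p)) (at p)" if "p \<in> S" for p
    using ev[OF _ that] Suc.prems(1) that by (simp add: frechet_derivative_works)
  have "frechet_derivative g (at p) = frechet_derivative f (at p)" if "p \<in> S" for p
    using frechet_derivative_at[OF der[OF that]] by simp
  then have "Cn_on n S (\<lambda>p. frechet_derivative g (at p) v)" for v
    using Suc.IH[of "\<lambda>p. frechet_derivative f (at p) v"] Suc.prems(1) by simp
  then show ?case using der by (auto simp: differentiable_def)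
qed

lemma smooth_on_cong:
  "open S \<Longrightarrow> smooth_on S f \<Longrightarrow> (\<And>p. p \<in> S \<Longrightarrow> f p = g p) \<Longrightarrow> smooth_on S g"
  unfolding smooth_on_def by (blast intro: Cn_on_cong)

text \<open>Every clause of \<open>Cn_on\<close> speaks of full derivatives or, at order 0, of
  continuity near single points, so it can be checked neighbourhood by neighbourhood. This serves
  functions such as the coefficients \<open>q1\<close> and \<open>q2\<close>, for which closed
  expressions exist only locally.\<close>

lemma Cn_on_local:
  assumes "\<And>p. p \<in> S \<Longrightarrow> \<exists>U. open U \<and> p \<in> U \<and> Cn_on n U f"
  shows "Cn_on n S f"
  using assms
proof (induction n arbitrary: f)
  case 0
  then have "isCont f p" if "p \<in> S" for p
    using that continuous_on_eq_continuous_at by (metis Cn_on.simps(1))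
  then show ?case by (simp add: continuous_at_imp_continuous_on)
next
  case (Suc n)
  have "Cn_on n S (\<lambda>p. frechet_derivative f (at p) v)" for v
    by (rule Suc.IH) (use Suc.prems in fastforce)
  then show ?case using Suc.prems by fastforce
qed

lemma smooth_on_local:
  assumes "\<And>p. p \<in> S \<Longrightarrow> \<exists>U. open U \<and> p \<in> U \<and> smooth_on U f"
  shows "smooth_on S f"
  unfolding smooth_on_def
proof
  show "Cn_on n S f" for n
    by (rule Cn_on_local) (use assms smooth_on_def in blast)
qed

text \<open>The successor clause does not mention continuity of \<open>f\<close> itself; it is
  recovered from differentiability in the base case.\<close>

lemma Cn_on_Suc_imp_Cn_on: "Cn_on (Suc n) S f \<Longrightarrow> Cn_on n S f"
proof (induction n arbitrary: f)
  case 0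
  then show ?case
    by (auto intro!: continuous_at_imp_continuous_on differentiable_imp_continuous_within)
qed auto

lemma smooth_on_differentiable: "smooth_on S f \<Longrightarrow> p \<in> S \<Longrightarrow> f differentiable (at p)"
  unfolding smooth_on_def by (metis Cn_on.simps(2))

lemma smooth_on_frechet_derivative:
  "smooth_on S f \<Longrightarrow> smooth_on S (\<lambda>p. frechet_derivative f (at p) v)"
  unfolding smooth_on_def by (metis Cn_on.simps(2))

lemma smooth_on_continuous: "smooth_on S f \<Longrightarrow> continuous_on S f"
  unfolding smooth_on_def by (metis Cn_on.simps(1))

section \<open>Closure of smoothness under sums, products and affine substitutions\<close>

lemma Cn_on_add:
  assumes "open S"
  shows "Cn_on n S f \<Longrightarrow> Cn_on n S g \<Longrightarrow> Cn_on n S (\<lambda>p. f p + g p)"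
proof (induction n arbitrary: f g)
  case 0
  then show ?case by (auto intro: continuous_intros)
next
  case (Suc n)
  have "((\<lambda>p. f p + g p) has_derivative
      (\<lambda>v. frechet_derivative f (at p) v + frechet_derivative g (at p) v)) (at p)" if "p \<in> S" for p
    using Suc.prems that by (auto simp: frechet_derivative_works intro!: has_derivative_add)
  note der = this
  have "Cn_on n S (\<lambda>p. frechet_derivative (\<lambda>p. f p + g p) (at p) v)" for v
    by (rule Cn_on_cong[OF assms, of _ "\<lambda>p. frechet_derivative f (at p) v + frechet_derivative g (at p) v"])
      (use Suc frechet_derivative_at[OF der] in \<open>auto dest: fun_cong\<close>)
  then show ?case using der by (auto simp: differentiable_def)
qed

text \<open>The product rule still contains the undifferentiated factors, so the induction
  hypothesis needs them at order \<open>n\<close>; lowering the order supplies this.\<close>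

lemma Cn_on_mult:
  fixes f g :: "'a::real_normed_vector \<Rightarrow> real"
  assumes "open S"
  shows "Cn_on n S f \<Longrightarrow> Cn_on n S g \<Longrightarrow> Cn_on n S (\<lambda>p. f p * g p)"
proof (induction n arbitrary: f g)
  case 0
  then show ?case by (auto intro: continuous_intros)
next
  case (Suc n)
  have "((\<lambda>p. f p * g p) has_derivative
      (\<lambda>v. f p * frechet_derivative g (at p) v + frechet_derivative f (at p) v * g p)) (at p)" if "p \<in> S" for p
    using Suc.prems that by (auto simp: frechet_derivative_works intro!: has_derivative_mult)
  note der = this
  have "Cn_on n S (\<lambda>p. f p * frechet_derivative g (at p) v + frechet_derivative f (at p) v * g p)" for v
    using Suc.prems Cn_on_Suc_imp_Cn_on[OF Suc.prems(1)] Cn_on_Suc_imp_Cn_on[OF Suc.prems(2)]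
    by (intro Cn_on_add[OF assms] Suc.IH) auto
  then have "Cn_on n S (\<lambda>p. frechet_derivative (\<lambda>p. f p * g p) (at p) v)" for v
    by (rule Cn_on_cong[OF assms])
      (use frechet_derivative_at[OF der] in \<open>auto dest: fun_cong\<close>)
  then show ?case using der by (auto simp: differentiable_def)
qed

text \<open>The derivative \<open>L\<close> of \<open>g\<close> is the same at every point. Hence
  the derivative of \<open>f (g p)\<close> along \<open>v\<close> is the derivative of
  \<open>f\<close> along the fixed vector \<open>L v\<close>, again composed with \<open>g\<close>,
  and the induction closes without any product rule.\<close>

lemma Cn_on_compose_affine:
  assumes "open S" "open T" "\<And>p. (g has_derivative L) (at p)" "g ` S \<subseteq> T"
  shows "Cn_on n T f \<Longrightarrow> Cn_on n S (\<lambda>p. f (g p))"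
proof (induction n arbitrary: f)
  case 0
  have "continuous_on S g"
    by (meson assms(3) continuous_at_imp_continuous_on has_derivative_continuous)
  then show ?case
    using 0 assms(4) by (auto intro: continuous_on_compose2)
next
  case (Suc n)
  have der: "((\<lambda>p. f (g p)) has_derivative (\<lambda>v. frechet_derivative f (at (g p)) (L v))) (at p)"
    if "p \<in> S" for p
    using diff_chain_at[OF assms(3), of f "frechet_derivative f (at (g p))" p] Suc.prems that assms(4)
    by (auto simp: frechet_derivative_works o_def)
  have "Cn_on n S (\<lambda>p. frechet_derivative (\<lambda>p. f (g p)) (at p) v)" for v
    by (rule Cn_on_cong[OF assms(1), of _ "\<lambda>p. frechet_derivative f (at (g p)) (L v)"])
      (use Suc.prems Suc.IH[of "\<lambda>p. frechet_derivative f (at p) (L v)"]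
        frechet_derivative_at[OF der] in \<open>auto dest: fun_cong\<close>)
  then show ?case using der by (auto simp: differentiable_def)
qed

lemma smooth_on_add:
  "open S \<Longrightarrow> smooth_on S f \<Longrightarrow> smooth_on S g \<Longrightarrow> smooth_on S (\<lambda>p. f p + g p)"
  unfolding smooth_on_def by (blast intro: Cn_on_add)

lemma smooth_on_mult:
  fixes f g :: "'a::real_normed_vector \<Rightarrow> real"
  shows "open S \<Longrightarrow> smooth_on S f \<Longrightarrow> smooth_on S g \<Longrightarrow> smooth_on S (\<lambda>p. f p * g p)"
  unfolding smooth_on_def by (blast intro: Cn_on_mult)

lemma smooth_on_compose_affine:
  assumes "open S" "open T" "\<And>p. (g has_derivative L) (at p)" "g ` S \<subseteq> T" "smooth_on T f"
  shows "smooth_on S (\<lambda>p. f (g p))"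
  using assms Cn_on_compose_affine unfolding smooth_on_def by blast

lemma Cn_on_const: "Cn_on n S (\<lambda>_. c)"
  by (induction n arbitrary: c) (auto simp: frechet_derivative_const)

lemma smooth_on_const: "smooth_on S (\<lambda>_. c)"
  by (simp add: smooth_on_def Cn_on_const)

text \<open>A bounded linear map is its own derivative everywhere, so all its directional
  derivatives are constant.\<close>

lemma smooth_on_bounded_linear:
  assumes "bounded_linear f"
  shows "smooth_on S f"
proof -
  have d: "(f has_derivative f) (at p)" for p
    by (rule bounded_linear_imp_has_derivative[OF assms])
  then have "frechet_derivative f (at p) = f" for p
    by (metis frechet_derivative_at)
  then have "Cn_on (Suc n) S f" for n
    using d by (auto simp: differentiable_def Cn_on_const)
  then show ?thesis
    unfolding smooth_on_def using Cn_on_Suc_imp_Cn_on by blast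
qed

section \<open>Partial derivatives\<close>

text \<open>Restricting the total derivative to the coordinate axes gives the one-variable
  derivatives, and linearity reassembles it from them. This connects the \<open>deriv\<close>-based
  partials with \<open>frechet_derivative\<close>.\<close>

lemma has_derivative_pd:
  assumes "w differentiable (at (a, b))"
  shows "(w has_derivative (\<lambda>(h, k). pd1 w (a, b) * h + pd2 w (a, b) * k)) (at (a, b))"
    and "pd1 w (a, b) = frechet_derivative w (at (a, b)) (1, 0)"
    and "pd2 w (a, b) = frechet_derivative w (at (a, b)) (0, 1)"
proof -
  let ?D = "frechet_derivative w (at (a, b))"
  have D: "(w has_derivative ?D) (at (a, b))"
    using assms by (simp add: frechet_derivative_works)
  interpret bounded_linear ?D
    by (rule has_derivative_bounded_linear[OF D])
  have D_scale: "?D (h, 0) = ?D (1, 0) * h" "?D (0, h) = ?D (0, 1) * h" for h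
    using scaleR[of h "(1, 0)"] scaleR[of h "(0, 1)"] by simp_all
  have D_split: "?D (h, k) = ?D (1, 0) * h + ?D (0, 1) * k" for h k
    using add[of "(h, 0)" "(0, k)"] D_scale(1)[of h] D_scale(2)[of k] by simp
  have "((\<lambda>s. w (s, b)) has_derivative (\<lambda>h. ?D (h, 0))) (at a)"
    using has_derivative_compose[OF has_derivative_Pair[OF has_derivative_ident has_derivative_const] D] .
  then have "((\<lambda>s. w (s, b)) has_real_derivative ?D (1, 0)) (at a)"
    unfolding has_field_derivative_def by (rule has_derivative_eq_rhs) (rule ext, rule D_scale)
  then show p1: "pd1 w (a, b) = ?D (1, 0)"
    by (simp add: pd1_def DERIV_imp_deriv)
  have "((\<lambda>s. w (a, s)) has_derivative (\<lambda>h. ?D (0, h))) (at b)"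
    using has_derivative_compose[OF has_derivative_Pair[OF has_derivative_const has_derivative_ident] D] .
  then have "((\<lambda>s. w (a, s)) has_real_derivative ?D (0, 1)) (at b)"
    unfolding has_field_derivative_def by (rule has_derivative_eq_rhs) (rule ext, rule D_scale)
  then show p2: "pd2 w (a, b) = ?D (0, 1)"
    by (simp add: pd2_def DERIV_imp_deriv)
  have "?D = (\<lambda>(h, k). pd1 w (a, b) * h + pd2 w (a, b) * k)"
    unfolding p1 p2 by (rule ext, clarify) (rule D_split)
  with D show "(w has_derivative (\<lambda>(h, k). pd1 w (a, b) * h + pd2 w (a, b) * k)) (at (a, b))"
    by simp
qed

text \<open>On \<open>W\<close> the partials are the directional derivatives along the unit vectors,
  which are smooth by the recursive definition of \<open>Cn_on\<close>.\<close>

lemma smooth_on_pd: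
  assumes "open W" "smooth_on W w"
  shows "smooth_on W (pd1 w)" "smooth_on W (pd2 w)"
proof -
  have "pd1 w p = frechet_derivative w (at p) (1, 0)" "pd2 w p = frechet_derivative w (at p) (0, 1)"
    if "p \<in> W" for p
    using has_derivative_pd(2,3)[of w "fst p" "snd p"] smooth_on_differentiable[OF assms(2) that]
    by simp_all
  then show "smooth_on W (pd1 w)" "smooth_on W (pd2 w)"
    by (auto intro: smooth_on_cong[OF assms(1) smooth_on_frechet_derivative[OF assms(2)]])
qed

text \<open>Chain rule along a curve. The derivative is a variable \<open>D\<close> fixed by an
  equation, so that the rule combines with \<open>derivative_eq_intros\<close> and the algebra is
  settled only at the end.\<close>

lemma DERIV_compose_pair:
  assumes "smooth_on W w" "(g s, h s) \<in> W"
    and "(g has_real_derivative g') (at s)" "(h has_real_derivative h') (at s)"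
    and "D = pd1 w (g s, h s) * g' + pd2 w (g s, h s) * h'"
  shows "((\<lambda>s. w (g s, h s)) has_real_derivative D) (at s)"
proof -
  have "((\<lambda>s. (g s, h s)) has_derivative (\<lambda>k. (g' * k, h' * k))) (at s)"
    using assms(3,4) unfolding has_field_derivative_def by (rule has_derivative_Pair)
  from has_derivative_compose[OF this
      has_derivative_pd(1)[OF smooth_on_differentiable[OF assms(1,2)]]]
  have "((\<lambda>s. w (g s, h s)) has_derivative (\<lambda>k. D * k)) (at s)"
    unfolding assms(5) by (simp add: algebra_simps)
  then show ?thesis
    by (simp add: has_field_derivative_def)
qed


lemma DERIV_pd:
  assumes "smooth_on W w" "(a, b) \<in> W"
  shows "((\<lambda>s. w (s, b)) has_real_derivative pd1 w (a, b)) (at a)"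
    and "((\<lambda>s. w (a, s)) has_real_derivative pd2 w (a, b)) (at b)"
  using DERIV_compose_pair[OF assms(1), of "\<lambda>s. s" a "\<lambda>_. b" 1 0]
    DERIV_compose_pair[OF assms(1), of "\<lambda>_. a" b "\<lambda>s. s" 0 1] assms(2)
  by simp_all

text \<open>Two applications of the mean value theorem write the second difference of \<open>w\<close> over a small
  square as either mixed derivative at some point of the square.\<close>
lemma pd1_pd2_commute:
  assumes "open W" "smooth_on W w" "(a, b) \<in> W"
  shows "pd1 (pd2 w) (a, b) = pd2 (pd1 w) (a, b)"
proof (rule ccontr)
  assume neq: "pd1 (pd2 w) (a, b) \<noteq> pd2 (pd1 w) (a, b)"
  \<comment> \<open>Half the gap between the two mixed derivatives: one number cannot lie within
    distance less than \<open>e\<close> of both.\<close>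
  define e where "e = \<bar>pd1 (pd2 w) (a, b) - pd2 (pd1 w) (a, b)\<bar> / 2"
  have "e > 0" using neq by (simp add: e_def)
  note sm = smooth_on_pd[OF assms(1)]
  have c1: "continuous (at (a, b)) (pd1 (pd2 w))" and c2: "continuous (at (a, b)) (pd2 (pd1 w))"
    using sm(1)[OF sm(2)[OF assms(2)]] sm(2)[OF sm(1)[OF assms(2)]] assms(1,3)
    by (meson smooth_on_continuous continuous_on_eq_continuous_at)+
  obtain d1 where d1: "d1 > 0" "\<And>q. dist q (a, b) < d1 \<Longrightarrow> dist (pd1 (pd2 w) q) (pd1 (pd2 w) (a, b)) < e"
    using c1 \<open>e > 0\<close> unfolding continuous_at_eps_delta by blast
  obtain d2 where d2: "d2 > 0" "\<And>q. dist q (a, b) < d2 \<Longrightarrow> dist (pd2 (pd1 w) q) (pd2 (pd1 w) (a, b)) < e"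
    using c2 \<open>e > 0\<close> unfolding continuous_at_eps_delta by blast
  obtain d3 where d3: "d3 > 0" "ball (a, b) d3 \<subseteq> W"
    using assms(1,3) open_contains_ball by blast
  \<comment> \<open>The factor 1/4 keeps the square of side \<open>h\<close> inside all three balls,
    since its points are at distance at most \<open>2 * h\<close> from
    \<open>(a, b)\<close>.\<close>
  define h where "h = min d1 (min d2 d3) / 4"
  have h: "h > 0" using d1 d2 d3 by (simp add: h_def)
  have box: "dist (s, t) (a, b) < min d1 (min d2 d3)"
    if "a \<le> s" "s \<le> a + h" "b \<le> t" "t \<le> b + h" for s t
  proof -
    have "dist (s, t) (a, b) \<le> dist s a + dist t b"
      by (simp add: dist_Pair_Pair sqrt_sum_squares_le_sum)
    also have "\<dots> \<le> 2 * h" using that by (simp add: dist_real_def)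
    finally show ?thesis using h by (simp add: h_def)
  qed
  have inW: "(s, t) \<in> W" if "a \<le> s" "s \<le> a + h" "b \<le> t" "t \<le> b + h" for s t
    using box[OF that] d3(2) by (auto simp: dist_commute)
  have "\<exists>z>a. z < a + h \<and> (w (a + h, b + h) - w (a + h, b)) - (w (a, b + h) - w (a, b))
      = (a + h - a) * (pd1 w (z, b + h) - pd1 w (z, b))"
    by (rule MVT2[where f = "\<lambda>s. w (s, b + h) - w (s, b)"])
      (use h in \<open>auto intro!: DERIV_diff DERIV_pd[OF assms(2)] inW\<close>)
  then obtain x1 where x1: "x1 > a" "x1 < a + h"
    "(w (a + h, b + h) - w (a + h, b)) - (w (a, b + h) - w (a, b)) = h * (pd1 w (x1, b + h) - pd1 w (x1, b))"
    by auto
  have "\<exists>z>b. z < b + h \<and> pd1 w (x1, b + h) - pd1 w (x1, b) = (b + h - b) * pd2 (pd1 w) (x1, z)"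
    by (rule MVT2[where f = "\<lambda>s. pd1 w (x1, s)"])
      (use h x1 in \<open>auto intro!: DERIV_pd[OF sm(1)[OF assms(2)]] inW\<close>)
  then obtain y1 where y1: "y1 > b" "y1 < b + h" "pd1 w (x1, b + h) - pd1 w (x1, b) = h * pd2 (pd1 w) (x1, y1)"
    by auto
  \<comment> \<open>The same second difference, now grouped the other way, so that the mean value
    theorem acts first in the second variable and yields the other order of differentiation.\<close>
  have "\<exists>z>b. z < b + h \<and> (w (a + h, b + h) - w (a, b + h)) - (w (a + h, b) - w (a, b))
      = (b + h - b) * (pd2 w (a + h, z) - pd2 w (a, z))"
    by (rule MVT2[where f = "\<lambda>s. w (a + h, s) - w (a, s)"])
      (use h in \<open>auto intro!: DERIV_diff DERIV_pd[OF assms(2)] inW\<close>)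
  then obtain y2 where y2: "y2 > b" "y2 < b + h"
    "(w (a + h, b + h) - w (a, b + h)) - (w (a + h, b) - w (a, b)) = h * (pd2 w (a + h, y2) - pd2 w (a, y2))"
    by auto
  have "\<exists>z>a. z < a + h \<and> pd2 w (a + h, y2) - pd2 w (a, y2) = (a + h - a) * pd1 (pd2 w) (z, y2)"
    by (rule MVT2[where f = "\<lambda>s. pd2 w (s, y2)"])
      (use h y2 in \<open>auto intro!: DERIV_pd[OF sm(2)[OF assms(2)]] inW\<close>)
  then obtain x2 where x2: "x2 > a" "x2 < a + h" "pd2 w (a + h, y2) - pd2 w (a, y2) = h * pd1 (pd2 w) (x2, y2)"
    by auto
  have "h * (h * pd2 (pd1 w) (x1, y1)) = h * (h * pd1 (pd2 w) (x2, y2))"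
    using x1(3) y2(3) unfolding y1(3) x2(3) by linarith
  then have "pd2 (pd1 w) (x1, y1) = pd1 (pd2 w) (x2, y2)" using h by simp
  moreover have "dist (pd2 (pd1 w) (x1, y1)) (pd2 (pd1 w) (a, b)) < e"
    using box[of x1 y1] x1 y1 by (intro d2) auto
  moreover have "dist (pd1 (pd2 w) (x2, y2)) (pd1 (pd2 w) (a, b)) < e"
    using box[of x2 y2] x2 y2 by (intro d1) auto
  ultimately show False
    unfolding e_def dist_real_def by (smt (verit) field_sum_of_halves)
qed

text \<open>By continuity the slice \<open>g\<close> stays in the open set \<open>S\<close> near
  \<open>s\<close>, where \<open>f\<close> and \<open>F\<close> agree, and \<open>deriv\<close> sees
  only values near \<open>s\<close>. This allows iterated partials, since a first partial is known
  in closed form only on the open domain.\<close>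

lemma deriv_slice_eqI:
  fixes f F :: "'a::topological_space \<Rightarrow> real"
  assumes "open S" "g s \<in> S" "isCont g s" "\<And>q. q \<in> S \<Longrightarrow> f q = F q"
    and "((\<lambda>r. F (g r)) has_real_derivative D) (at s)"
  shows "deriv (\<lambda>r. f (g r)) s = D"
proof -
  have "\<forall>\<^sub>F r in nhds s. g r \<in> S"
    using assms(1-3) by (simp add: continuous_at_open eventually_nhds)
  then have "\<forall>\<^sub>F r in nhds s. f (g r) = F (g r)"
    by eventually_elim (rule assms(4))
  then have "deriv (\<lambda>r. f (g r)) s = deriv (\<lambda>r. F (g r)) s"
    by (rule deriv_cong_ev) simp
  then show ?thesis
    using DERIV_imp_deriv[OF assms(5)] by simp
qed

lemma pd_eqI:
  assumes "open S" "(t, x, y) \<in> S" "\<And>t x y. (t, x, y) \<in> S \<Longrightarrow> f (t, x, y) = F t x y"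
  shows pd_t_eqI: "((\<lambda>s. F s x y) has_real_derivative D) (at t) \<Longrightarrow> pd_t f (t, x, y) = D"
    and pd_x_eqI: "((\<lambda>s. F t s y) has_real_derivative D) (at x) \<Longrightarrow> pd_x f (t, x, y) = D"
    and pd_y_eqI: "((\<lambda>s. F t x s) has_real_derivative D) (at y) \<Longrightarrow> pd_y f (t, x, y) = D"
  using deriv_slice_eqI[OF assms(1), of "\<lambda>s. (s, x, y)" t f "\<lambda>(t, x, y). F t x y"]
    deriv_slice_eqI[OF assms(1), of "\<lambda>s. (t, s, y)" x f "\<lambda>(t, x, y). F t x y"]
    deriv_slice_eqI[OF assms(1), of "\<lambda>s. (t, x, s)" y f "\<lambda>(t, x, y). F t x y"] assms(2,3)
  by (auto simp: pd_t_def pd_x_def pd_y_def intro!: continuous_intros)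

lemma pd2_eqI:
  assumes "open S" "(a, b) \<in> S" "\<And>a b. (a, b) \<in> S \<Longrightarrow> f (a, b) = F a b"
    and "((\<lambda>s. F a s) has_real_derivative D) (at b)"
  shows "pd2 f (a, b) = D"
  using deriv_slice_eqI[OF assms(1), of "\<lambda>s. (a, s)" b f "\<lambda>(a, b). F a b"] assms(2-)
  by (auto simp: pd2_def intro!: continuous_intros)

text \<open>The three-variable counterpart of \<open>has_derivative_pd\<close>, by the same
  restriction to the axes.\<close>

lemma frechet_derivative_eq_pd:
  assumes "u differentiable (at (t, x, y))"
  shows "frechet_derivative u (at (t, x, y)) (a, b, c)
    = pd_t u (t, x, y) * a + pd_x u (t, x, y) * b + pd_y u (t, x, y) * c"
proof -
  let ?D = "frechet_derivative u (at (t, x, y))"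
  have D: "(u has_derivative ?D) (at (t, x, y))"
    using assms by (simp add: frechet_derivative_works)
  interpret bounded_linear ?D
    by (rule has_derivative_bounded_linear[OF D])
  have D_scale: "?D (h, 0, 0) = ?D (1, 0, 0) * h" "?D (0, h, 0) = ?D (0, 1, 0) * h"
    "?D (0, 0, h) = ?D (0, 0, 1) * h" for h
    using scaleR[of h "(1, 0, 0)"] scaleR[of h "(0, 1, 0)"] scaleR[of h "(0, 0, 1)"] by simp_all
  have "((\<lambda>s. u (s, x, y)) has_derivative (\<lambda>h. ?D (h, 0, 0))) (at t)"
    using has_derivative_compose[OF has_derivative_Pair[OF has_derivative_ident
      has_derivative_Pair[OF has_derivative_const has_derivative_const]] D] .
  then have "((\<lambda>s. u (s, x, y)) has_real_derivative ?D (1, 0, 0)) (at t)"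
    unfolding has_field_derivative_def by (rule has_derivative_eq_rhs) (rule ext, rule D_scale)
  then have pt: "pd_t u (t, x, y) = ?D (1, 0, 0)"
    by (simp add: pd_t_def DERIV_imp_deriv)
  have "((\<lambda>s. u (t, s, y)) has_derivative (\<lambda>h. ?D (0, h, 0))) (at x)"
    using has_derivative_compose[OF has_derivative_Pair[OF has_derivative_const
      has_derivative_Pair[OF has_derivative_ident has_derivative_const]] D] .
  then have "((\<lambda>s. u (t, s, y)) has_real_derivative ?D (0, 1, 0)) (at x)"
    unfolding has_field_derivative_def by (rule has_derivative_eq_rhs) (rule ext, rule D_scale)
  then have px: "pd_x u (t, x, y) = ?D (0, 1, 0)"
    by (simp add: pd_x_def DERIV_imp_deriv)
  have "((\<lambda>s. u (t, x, s)) has_derivative (\<lambda>h. ?D (0, 0, h))) (at y)"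
    using has_derivative_compose[OF has_derivative_Pair[OF has_derivative_const
      has_derivative_Pair[OF has_derivative_const has_derivative_ident]] D] .
  then have "((\<lambda>s. u (t, x, s)) has_real_derivative ?D (0, 0, 1)) (at y)"
    unfolding has_field_derivative_def by (rule has_derivative_eq_rhs) (rule ext, rule D_scale)
  then have py: "pd_y u (t, x, y) = ?D (0, 0, 1)"
    by (simp add: pd_y_def DERIV_imp_deriv)
  have "?D (a, b, c) = ?D (a, 0, 0) + ?D (0, b, 0) + ?D (0, 0, c)"
    using add[of "(a, 0, 0)" "(0, b, 0)"] add[of "(a, b, 0)" "(0, 0, c)"] by simp
  then show ?thesis
    unfolding pt px py by (simp only: D_scale[of a] D_scale[of b] D_scale[of c])
qed

section \<open>Similarity reductions\<close>

text \<open>The derivative of the graph map sends \<open>(a, b, c)\<close> to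
  \<open>(a, b, c, u_t a + u_x b + u_y c)\<close>, so tangency amounts to finding such a triple for
  the value of \<open>X\<close>. The ansatz \<open>U\<close> and its partials enter as explicit
  expressions.\<close>

lemma invariant_onI:
  assumes "open \<Omega>" "smooth_on \<Omega> u" "\<And>t x y. (t, x, y) \<in> \<Omega> \<Longrightarrow> u (t, x, y) = U t x y"
    and "\<And>t x y. (t, x, y) \<in> \<Omega> \<Longrightarrow> ((\<lambda>s. U s x y) has_real_derivative ut t x y) (at t)"
    and "\<And>t x y. (t, x, y) \<in> \<Omega> \<Longrightarrow> ((\<lambda>s. U t s y) has_real_derivative ux t x y) (at x)"
    and "\<And>t x y. (t, x, y) \<in> \<Omega> \<Longrightarrow> ((\<lambda>s. U t x s) has_real_derivative uy t x y) (at y)"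
    and "\<And>t x y. (t, x, y) \<in> \<Omega> \<Longrightarrow> \<exists>a b c. X (t, x, y, U t x y) =
      (a, b, c, ut t x y * a + ux t x y * b + uy t x y * c)"
  shows "invariant_on \<Omega> X u"
  unfolding invariant_on_def
proof clarify
  fix t x y
  assume p: "(t, x, y) \<in> \<Omega>"
  let ?D = "frechet_derivative u (at (t, x, y))"
  have diff: "u differentiable (at (t, x, y))"
    by (rule smooth_on_differentiable[OF assms(2) p])
  then have D: "(u has_derivative ?D) (at (t, x, y))"
    by (simp add: frechet_derivative_works)
  have "graph_map u = (\<lambda>p. (fst p, fst (snd p), snd (snd p), u p))"
    by (auto simp: graph_map_def)
  then have "(graph_map u has_derivative (\<lambda>v. (fst v, fst (snd v), snd (snd v), ?D v))) (at (t, x, y))"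
    using D by (auto intro!: has_derivative_Pair has_derivative_fst has_derivative_snd has_derivative_ident)
  from frechet_derivative_at[OF this, symmetric]
  have G: "frechet_derivative (graph_map u) (at (t, x, y)) (a, b, c) =
      (a, b, c, ut t x y * a + ux t x y * b + uy t x y * c)" for a b c
    using pd_eqI[where F = U, OF assms(1) p assms(3)] assms(4-6)[OF p]
    by (simp add: frechet_derivative_eq_pd[OF diff])
  obtain a b c where "X (t, x, y, U t x y) =
      (a, b, c, ut t x y * a + ux t x y * b + uy t x y * c)"
    using assms(7)[OF p] by blast
  then have "X (graph_map u (t, x, y)) = frechet_derivative (graph_map u) (at (t, x, y)) (a, b, c)"
    unfolding G by (simp add: graph_map_def assms(3)[OF p])
  then show "X (graph_map u (t, x, y)) \<in> range (frechet_derivative (graph_map u) (at (t, x, y)))"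
    by (rule range_eqI)
qed

text \<open>All derivatives in the equation are replaced by closed forms obtained from
  \<open>U\<close>. The map \<open>f\<close> sends a base point to its similarity variables; as the
  resulting condition depends on the point only through \<open>f\<close>, it becomes a condition on
  the image of \<open>\<Omega>\<close>.\<close>

lemma solves_ZK_iff:
  assumes "open \<Omega>" "\<And>t x y. (t, x, y) \<in> \<Omega> \<Longrightarrow> u (t, x, y) = U t x y"
    and ux: "\<And>t x y. (t, x, y) \<in> \<Omega> \<Longrightarrow> ((\<lambda>s. U t s y) has_real_derivative ux t x y) (at x)"
    and uy: "\<And>t x y. (t, x, y) \<in> \<Omega> \<Longrightarrow> ((\<lambda>s. U t x s) has_real_derivative uy t x y) (at y)"
    and utx: "\<And>t x y. (t, x, y) \<in> \<Omega> \<Longrightarrow> ((\<lambda>s. ux s x y) has_real_derivative utx t x y) (at t)"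
    and uxx: "\<And>t x y. (t, x, y) \<in> \<Omega> \<Longrightarrow> ((\<lambda>s. ux t s y) has_real_derivative uxx t x y) (at x)"
    and uyy: "\<And>t x y. (t, x, y) \<in> \<Omega> \<Longrightarrow> ((\<lambda>s. uy t x s) has_real_derivative uyy t x y) (at y)"
    and E: "\<And>t x y. (t, x, y) \<in> \<Omega> \<Longrightarrow>
      utx t x y - ((ux t x y)\<^sup>2 + U t x y * uxx t x y) - uyy t x y = 0 \<longleftrightarrow> E (f (t, x, y))"
  shows "solves_ZK_on \<Omega> u \<longleftrightarrow> (\<forall>q \<in> f ` \<Omega>. E q)"
proof -
  have pdx: "pd_x u (t, x, y) = ux t x y" and pdy: "pd_y u (t, x, y) = uy t x y"
    if "(t, x, y) \<in> \<Omega>" for t x y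
    using pd_x_eqI[where F = U, OF assms(1) that assms(2) ux[OF that]]
      pd_y_eqI[where F = U, OF assms(1) that assms(2) uy[OF that]]
    by simp_all
  have "pd_t (pd_x u) (t, x, y) = utx t x y" "pd_y (pd_y u) (t, x, y) = uyy t x y"
    "pd_x (\<lambda>q. u q * pd_x u q) (t, x, y) = (ux t x y)\<^sup>2 + U t x y * uxx t x y"
    if p: "(t, x, y) \<in> \<Omega>" for t x y
  proof -
    show "pd_t (pd_x u) (t, x, y) = utx t x y"
      by (rule pd_t_eqI[OF assms(1) p, of _ ux]) (use pdx utx p in auto)
    show "pd_y (pd_y u) (t, x, y) = uyy t x y"
      by (rule pd_y_eqI[OF assms(1) p, of _ uy]) (use pdy uyy p in auto)
    \<comment> \<open>The product rule gives (u u_x)_x = u_x^2 + u u_xx, applied to closed forms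
      valid near the point.\<close>
    show "pd_x (\<lambda>q. u q * pd_x u q) (t, x, y) = (ux t x y)\<^sup>2 + U t x y * uxx t x y"
      by (rule pd_x_eqI[OF assms(1) p, of _ "\<lambda>t x y. U t x y * ux t x y"])
        (auto simp: pdx assms(2) power2_eq_square intro!: derivative_eq_intros ux[OF p] uxx[OF p])
  qed
  then have "pd_t (pd_x u) p - pd_x (\<lambda>q. u q * pd_x u q) p - pd_y (pd_y u) p = 0 \<longleftrightarrow> E (f p)"
    if "p \<in> \<Omega>" for p
    using E that by (cases p) auto
  then show ?thesis
    unfolding solves_ZK_on_def by simp
qed

section \<open>The reductions for each symmetry algebra\<close>

context
  fixes \<Omega> :: "base_point set" and u :: "base_point \<Rightarrow> real"
    and W :: "(real \<times> real) set" and w :: "real \<times> real \<Rightarrow> real"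
  assumes \<Omega>: "open \<Omega>" and u: "smooth_on \<Omega> u" and W: "open W" and w: "smooth_on W w"
begin

text \<open>Chain rules for \<open>w\<close> and both of its first partials, which is all that a
  second-order equation requires.\<close>

lemmas DERIV_w = DERIV_compose_pair[OF w]
  DERIV_compose_pair[OF smooth_on_pd(1)[OF W w]]
  DERIV_compose_pair[OF smooth_on_pd(2)[OF W w]]

text \<open>Since u_x = 0, both the mixed and the nonlinear term vanish and only -u_yy
  remains.\<close>

lemma reduction_x1:
  assumes "\<And>t x y. (t, x, y) \<in> \<Omega> \<Longrightarrow> (t, y) \<in> W" "\<And>t x y. (t, x, y) \<in> \<Omega> \<Longrightarrow> u (t, x, y) = w (t, y)"
  shows "invariant_on \<Omega> x1 u"
    and "solves_ZK_on \<Omega> u \<longleftrightarrow>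
      (\<forall>(t, y) \<in> (\<lambda>(t, x, y). (t, y)) ` \<Omega>. pd2 (pd2 w) (t, y) = 0)"
proof -
  show "invariant_on \<Omega> x1 u"
    by (rule invariant_onI[where U = "\<lambda>t x y. w (t, y)", OF \<Omega> u assms(2), where ut = "\<lambda>t x y. pd1 w (t, y)"
          and ux = "\<lambda>t x y. 0" and uy = "\<lambda>t x y. pd2 w (t, y)"])
      (auto simp: x1_def assms intro!: derivative_eq_intros DERIV_w)
  show "solves_ZK_on \<Omega> u \<longleftrightarrow>
      (\<forall>(t, y) \<in> (\<lambda>(t, x, y). (t, y)) ` \<Omega>. pd2 (pd2 w) (t, y) = 0)"
    by (rule solves_ZK_iff[where U = "\<lambda>t x y. w (t, y)", OF \<Omega> assms(2), where ux = "\<lambda>t x y. 0" and uy = "\<lambda>t x y. pd2 w (t, y)"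
          and utx = "\<lambda>t x y. 0" and uxx = "\<lambda>t x y. 0" and uyy = "\<lambda>t x y. pd2 (pd2 w) (t, y)"])
      (auto simp: assms intro!: derivative_eq_intros DERIV_w)
qed

text \<open>Here u_yy = 0. Differentiating first in x and then in t already produces the mixed
  partial in the order \<open>pd1 (pd2 w)\<close> of the reduced equation.\<close>

lemma reduction_y1:
  assumes "\<And>t x y. (t, x, y) \<in> \<Omega> \<Longrightarrow> (t, x) \<in> W" "\<And>t x y. (t, x, y) \<in> \<Omega> \<Longrightarrow> u (t, x, y) = w (t, x)"
  shows "invariant_on \<Omega> y1 u"
    and "solves_ZK_on \<Omega> u \<longleftrightarrow>
      (\<forall>(t, x) \<in> (\<lambda>(t, x, y). (t, x)) ` \<Omega>.
        - (pd2 w (t, x))\<^sup>2 + pd1 (pd2 w) (t, x) - w (t, x) * pd2 (pd2 w) (t, x) = 0)"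
proof -
  show "invariant_on \<Omega> y1 u"
    by (rule invariant_onI[where U = "\<lambda>t x y. w (t, x)", OF \<Omega> u assms(2), where ut = "\<lambda>t x y. pd1 w (t, x)"
          and ux = "\<lambda>t x y. pd2 w (t, x)" and uy = "\<lambda>t x y. 0"])
      (auto simp: y1_def assms intro!: derivative_eq_intros DERIV_w)
  show "solves_ZK_on \<Omega> u \<longleftrightarrow>
      (\<forall>(t, x) \<in> (\<lambda>(t, x, y). (t, x)) ` \<Omega>.
        - (pd2 w (t, x))\<^sup>2 + pd1 (pd2 w) (t, x) - w (t, x) * pd2 (pd2 w) (t, x) = 0)"
    by (rule solves_ZK_iff[where U = "\<lambda>t x y. w (t, x)", OF \<Omega> assms(2), where ux = "\<lambda>t x y. pd2 w (t, x)" and uy = "\<lambda>t x y. 0"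
          and utx = "\<lambda>t x y. pd1 (pd2 w) (t, x)" and uxx = "\<lambda>t x y. pd2 (pd2 w) (t, x)"
          and uyy = "\<lambda>t x y. 0"])
      (auto simp: assms intro!: derivative_eq_intros DERIV_w)
qed

text \<open>With u_tx = 0, the equation is the negative of the reduced one.\<close>

lemma reduction_z1:
  assumes "\<And>t x y. (t, x, y) \<in> \<Omega> \<Longrightarrow> (x, y) \<in> W" "\<And>t x y. (t, x, y) \<in> \<Omega> \<Longrightarrow> u (t, x, y) = w (x, y)"
  shows "invariant_on \<Omega> z1 u"
    and "solves_ZK_on \<Omega> u \<longleftrightarrow>
      (\<forall>(x, y) \<in> (\<lambda>(t, x, y). (x, y)) ` \<Omega>.
        (pd1 w (x, y))\<^sup>2 + w (x, y) * pd1 (pd1 w) (x, y) + pd2 (pd2 w) (x, y) = 0)"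
proof -
  show "invariant_on \<Omega> z1 u"
    by (rule invariant_onI[where U = "\<lambda>t x y. w (x, y)", OF \<Omega> u assms(2), where ut = "\<lambda>t x y. 0"
          and ux = "\<lambda>t x y. pd1 w (x, y)" and uy = "\<lambda>t x y. pd2 w (x, y)"])
      (auto simp: z1_def assms intro!: derivative_eq_intros DERIV_w)
  show "solves_ZK_on \<Omega> u \<longleftrightarrow>
      (\<forall>(x, y) \<in> (\<lambda>(t, x, y). (x, y)) ` \<Omega>.
        (pd1 w (x, y))\<^sup>2 + w (x, y) * pd1 (pd1 w) (x, y) + pd2 (pd2 w) (x, y) = 0)"
    by (rule solves_ZK_iff[where U = "\<lambda>t x y. w (x, y)", OF \<Omega> assms(2), where ux = "\<lambda>t x y. pd1 w (x, y)"
          and uy = "\<lambda>t x y. pd2 w (x, y)" and utx = "\<lambda>t x y. 0"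
          and uxx = "\<lambda>t x y. pd1 (pd1 w) (x, y)" and uyy = "\<lambda>t x y. pd2 (pd2 w) (x, y)"])
      (auto simp: assms intro!: derivative_eq_intros DERIV_w)
qed

text \<open>For z = y^2/x one gets u_x = w - z w_z and u_y = 2 y w_z, so 2 x u_x + y u_y = 2 x w = 2
  u, which is tangency. In the equation, the factor x of u cancels the 1/x in u_xx.\<close>

lemma reduction_v0:
  assumes "\<And>t x y. (t, x, y) \<in> \<Omega> \<Longrightarrow> x \<noteq> 0" "\<And>t x y. (t, x, y) \<in> \<Omega> \<Longrightarrow> (t, y\<^sup>2 / x) \<in> W"
    and "\<And>t x y. (t, x, y) \<in> \<Omega> \<Longrightarrow> u (t, x, y) = x * w (t, y\<^sup>2 / x)"
  shows "invariant_on \<Omega> v0 u"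
    and "solves_ZK_on \<Omega> u \<longleftrightarrow>
      (\<forall>(r, z) \<in> (\<lambda>(t, x, y). (t, y\<^sup>2 / x)) ` \<Omega>.
        pd1 w (r, z) - 2 * pd2 w (r, z) - (w (r, z) - z * pd2 w (r, z))\<^sup>2
        - z * pd2 (pd1 w) (r, z) - 4 * z * pd2 (pd2 w) (r, z)
        - z\<^sup>2 * w (r, z) * pd2 (pd2 w) (r, z) = 0)"
proof -
  have ux: "((\<lambda>s. s * w (t, y\<^sup>2 / s)) has_real_derivative
      w (t, y\<^sup>2 / x) - y\<^sup>2 / x * pd2 w (t, y\<^sup>2 / x)) (at x)"
    and uy: "((\<lambda>s. x * w (t, s\<^sup>2 / x)) has_real_derivative 2 * y * pd2 w (t, y\<^sup>2 / x)) (at y)"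
    if "(t, x, y) \<in> \<Omega>" for t x y
    using assms(1,2)[OF that]
    by (auto intro!: derivative_eq_intros DERIV_w simp: field_simps power2_eq_square)
  show "invariant_on \<Omega> v0 u"
    by (rule invariant_onI[where U = "\<lambda>t x y. x * w (t, y\<^sup>2 / x)" and
        ux = "\<lambda>t x y. w (t, y\<^sup>2 / x) - y\<^sup>2 / x * pd2 w (t, y\<^sup>2 / x)" and
        uy = "\<lambda>t x y. 2 * y * pd2 w (t, y\<^sup>2 / x)", OF \<Omega> u assms(3) _ ux uy, where ut = "\<lambda>t x y. x * pd1 w (t, y\<^sup>2 / x)"])
      (use assms(1,2) in \<open>auto simp: v0_def field_simps power2_eq_square
        intro!: derivative_eq_intros DERIV_w\<close>)
  show "solves_ZK_on \<Omega> u \<longleftrightarrow>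
      (\<forall>(r, z) \<in> (\<lambda>(t, x, y). (t, y\<^sup>2 / x)) ` \<Omega>.
        pd1 w (r, z) - 2 * pd2 w (r, z) - (w (r, z) - z * pd2 w (r, z))\<^sup>2
        - z * pd2 (pd1 w) (r, z) - 4 * z * pd2 (pd2 w) (r, z)
        - z\<^sup>2 * w (r, z) * pd2 (pd2 w) (r, z) = 0)"
  proof (rule solves_ZK_iff[where U = "\<lambda>t x y. x * w (t, y\<^sup>2 / x)" and
        ux = "\<lambda>t x y. w (t, y\<^sup>2 / x) - y\<^sup>2 / x * pd2 w (t, y\<^sup>2 / x)" and
        uy = "\<lambda>t x y. 2 * y * pd2 w (t, y\<^sup>2 / x)", OF \<Omega> assms(3) ux uy, where
        utx = "\<lambda>t x y. pd1 w (t, y\<^sup>2 / x) - y\<^sup>2 / x * pd2 (pd1 w) (t, y\<^sup>2 / x)" and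
        uxx = "\<lambda>t x y. (y\<^sup>2 / x)\<^sup>2 / x * pd2 (pd2 w) (t, y\<^sup>2 / x)" and
        uyy = "\<lambda>t x y. 2 * pd2 w (t, y\<^sup>2 / x) + 4 * (y\<^sup>2 / x) * pd2 (pd2 w) (t, y\<^sup>2 / x)"])
    fix t x y
    assume p: "(t, x, y) \<in> \<Omega>"
    note x = assms(1)[OF p] and zW = assms(2)[OF p]
    \<comment> \<open>Differentiating w_z in t gives \<open>pd1 (pd2 w)\<close>, whereas the reduced
      equation contains \<open>pd2 (pd1 w)\<close>; symmetry of the mixed derivatives identifies
      them.\<close>
    show "((\<lambda>s. w (s, y\<^sup>2 / x) - y\<^sup>2 / x * pd2 w (s, y\<^sup>2 / x)) has_real_derivative
        pd1 w (t, y\<^sup>2 / x) - y\<^sup>2 / x * pd2 (pd1 w) (t, y\<^sup>2 / x)) (at t)"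
      using x zW by (auto intro!: derivative_eq_intros DERIV_w simp: pd1_pd2_commute[OF W w zW])
    \<comment> \<open>The two terms with w_z cancel, and z_x = -z/x leaves z^2 w_zz / x.\<close>
    show "((\<lambda>s. w (t, y\<^sup>2 / s) - y\<^sup>2 / s * pd2 w (t, y\<^sup>2 / s)) has_real_derivative
        (y\<^sup>2 / x)\<^sup>2 / x * pd2 (pd2 w) (t, y\<^sup>2 / x)) (at x)"
      using x zW by (auto intro!: derivative_eq_intros DERIV_w simp: field_simps power2_eq_square)
    show "((\<lambda>s. 2 * s * pd2 w (t, s\<^sup>2 / x)) has_real_derivative
        2 * pd2 w (t, y\<^sup>2 / x) + 4 * (y\<^sup>2 / x) * pd2 (pd2 w) (t, y\<^sup>2 / x)) (at y)"
      using x zW by (auto intro!: derivative_eq_intros DERIV_w simp: field_simps power2_eq_square)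
  qed (use assms(1) in \<open>auto simp: algebra_simps\<close>)
qed

text \<open>The field annihilates both similarity variables: on r it gives 2 k0 - 2 k0 x / x = 0, on
  z the contributions of x and y cancel. It multiplies x by 2 k0, hence also u = x w, which matches
  its u-component.\<close>

lemma reduction_v0_z1:
  assumes "\<And>t x y. (t, x, y) \<in> \<Omega> \<Longrightarrow> x > 0"
    and "\<And>t x y. (t, x, y) \<in> \<Omega> \<Longrightarrow> (2 * k0 * t - ln x, y\<^sup>2 / x) \<in> W"
    and "\<And>t x y. (t, x, y) \<in> \<Omega> \<Longrightarrow> u (t, x, y) = x * w (2 * k0 * t - ln x, y\<^sup>2 / x)"
  shows "invariant_on \<Omega> (\<lambda>p. k0 *\<^sub>R v0 p + z1 p) u"
    and "solves_ZK_on \<Omega> u \<longleftrightarrow>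
      (\<forall>(r, z) \<in> (\<lambda>(t, x, y). (2 * k0 * t - ln x, y\<^sup>2 / x)) ` \<Omega>.
        2 * pd2 w (r, z) + (- w (r, z) + pd1 w (r, z) + z * pd2 w (r, z))\<^sup>2
        + 2 * k0 * (pd1 (pd1 w) (r, z) + z * pd2 (pd1 w) (r, z))
        + 4 * z * pd2 (pd2 w) (r, z)
        + w (r, z) * (- pd1 w (r, z) + pd1 (pd1 w) (r, z)
            + z * (2 * pd2 (pd1 w) (r, z) + z * pd2 (pd2 w) (r, z)))
        - 2 * k0 * pd1 w (r, z) = 0)"
proof -
  let ?q = "\<lambda>t x y. (2 * k0 * t - ln x, y\<^sup>2 / x)"
  have ux: "((\<lambda>s. s * w (2 * k0 * t - ln s, y\<^sup>2 / s)) has_real_derivative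
      w (?q t x y) - pd1 w (?q t x y) - y\<^sup>2 / x * pd2 w (?q t x y)) (at x)"
    and uy: "((\<lambda>s. x * w (2 * k0 * t - ln x, s\<^sup>2 / x)) has_real_derivative
      2 * y * pd2 w (?q t x y)) (at y)"
    if "(t, x, y) \<in> \<Omega>" for t x y
    using assms(1,2)[OF that]
    by (auto intro!: derivative_eq_intros DERIV_w simp: field_simps power2_eq_square)
  show "invariant_on \<Omega> (\<lambda>p. k0 *\<^sub>R v0 p + z1 p) u"
  proof (rule invariant_onI[where U = "\<lambda>t x y. x * w (2 * k0 * t - ln x, y\<^sup>2 / x)" and
        ux = "\<lambda>t x y. w (?q t x y) - pd1 w (?q t x y) - y\<^sup>2 / x * pd2 w (?q t x y)" and
        uy = "\<lambda>t x y. 2 * y * pd2 w (?q t x y)", OF \<Omega> u assms(3) _ ux uy, where ut = "\<lambda>t x y. 2 * k0 * x * pd1 w (?q t x y)"])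
    fix t x y
    assume p: "(t, x, y) \<in> \<Omega>"
    note x = assms(1)[OF p] and zW = assms(2)[OF p]
    show "((\<lambda>s. x * w (?q s x y)) has_real_derivative 2 * k0 * x * pd1 w (?q t x y)) (at t)"
      using x zW by (auto intro!: derivative_eq_intros DERIV_w)
    \<comment> \<open>The triple (1, 2 k0 x, k0 y) is forced by the first three components of the
      field; only the u-component needs computation.\<close>
    have "k0 *\<^sub>R v0 (t, x, y, x * w (?q t x y)) + z1 (t, x, y, x * w (?q t x y)) =
        (1, 2 * k0 * x, k0 * y, 2 * k0 * x * pd1 w (?q t x y) * 1
          + (w (?q t x y) - pd1 w (?q t x y) - y\<^sup>2 / x * pd2 w (?q t x y)) * (2 * k0 * x)
          + 2 * y * pd2 w (?q t x y) * (k0 * y))"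
      using x by (simp add: v0_def z1_def algebra_simps power2_eq_square)
    then show "\<exists>a b c. k0 *\<^sub>R v0 (t, x, y, x * w (?q t x y)) + z1 (t, x, y, x * w (?q t x y)) =
        (a, b, c, 2 * k0 * x * pd1 w (?q t x y) * a
          + (w (?q t x y) - pd1 w (?q t x y) - y\<^sup>2 / x * pd2 w (?q t x y)) * b
          + 2 * y * pd2 w (?q t x y) * c)"
      by blast
  qed
  show "solves_ZK_on \<Omega> u \<longleftrightarrow>
      (\<forall>(r, z) \<in> (\<lambda>(t, x, y). (2 * k0 * t - ln x, y\<^sup>2 / x)) ` \<Omega>.
        2 * pd2 w (r, z) + (- w (r, z) + pd1 w (r, z) + z * pd2 w (r, z))\<^sup>2
        + 2 * k0 * (pd1 (pd1 w) (r, z) + z * pd2 (pd1 w) (r, z))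
        + 4 * z * pd2 (pd2 w) (r, z)
        + w (r, z) * (- pd1 w (r, z) + pd1 (pd1 w) (r, z)
            + z * (2 * pd2 (pd1 w) (r, z) + z * pd2 (pd2 w) (r, z)))
        - 2 * k0 * pd1 w (r, z) = 0)"
  proof (rule solves_ZK_iff[where U = "\<lambda>t x y. x * w (2 * k0 * t - ln x, y\<^sup>2 / x)" and
        ux = "\<lambda>t x y. w (?q t x y) - pd1 w (?q t x y) - y\<^sup>2 / x * pd2 w (?q t x y)" and
        uy = "\<lambda>t x y. 2 * y * pd2 w (?q t x y)", OF \<Omega> assms(3) ux uy, where
        utx = "\<lambda>t x y. 2 * k0 * (pd1 w (?q t x y) - pd1 (pd1 w) (?q t x y)
          - y\<^sup>2 / x * pd2 (pd1 w) (?q t x y))" and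
        uxx = "\<lambda>t x y. (- pd1 w (?q t x y) + pd1 (pd1 w) (?q t x y)
          + y\<^sup>2 / x * (2 * pd2 (pd1 w) (?q t x y) + y\<^sup>2 / x * pd2 (pd2 w) (?q t x y))) / x" and
        uyy = "\<lambda>t x y. 2 * pd2 w (?q t x y) + 4 * (y\<^sup>2 / x) * pd2 (pd2 w) (?q t x y)"])
    fix t x y
    assume p: "(t, x, y) \<in> \<Omega>"
    note x = assms(1)[OF p] and zW = assms(2)[OF p]
    note comm = pd1_pd2_commute[OF W w zW]
    show "((\<lambda>s. w (?q s x y) - pd1 w (?q s x y) - y\<^sup>2 / x * pd2 w (?q s x y)) has_real_derivative
        2 * k0 * (pd1 w (?q t x y) - pd1 (pd1 w) (?q t x y) - y\<^sup>2 / x * pd2 (pd1 w) (?q t x y))) (at t)"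
      using x zW unfolding comm[symmetric]
      by (auto intro!: derivative_eq_intros DERIV_w simp: algebra_simps)
    \<comment> \<open>Since r_x = -1/x and z_x = -z/x, every term carries 1/x. The terms with w_z
      cancel, and the two mixed terms merge into 2 z w_rz by symmetry.\<close>
    show "((\<lambda>s. w (?q t s y) - pd1 w (?q t s y) - y\<^sup>2 / s * pd2 w (?q t s y)) has_real_derivative
        (- pd1 w (?q t x y) + pd1 (pd1 w) (?q t x y)
          + y\<^sup>2 / x * (2 * pd2 (pd1 w) (?q t x y) + y\<^sup>2 / x * pd2 (pd2 w) (?q t x y))) / x) (at x)"
      using x zW comm by (auto intro!: derivative_eq_intros DERIV_w simp: field_simps power2_eq_square)
    show "((\<lambda>s. 2 * s * pd2 w (?q t x s)) has_real_derivative
        2 * pd2 w (?q t x y) + 4 * (y\<^sup>2 / x) * pd2 (pd2 w) (?q t x y)) (at y)"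
      using x zW by (auto intro!: derivative_eq_intros DERIV_w simp: field_simps power2_eq_square)
  next
    fix t x y
    assume "(t, x, y) \<in> \<Omega>"
    then have "x \<noteq> 0" using assms(1) by force
    \<comment> \<open>The factor x of u cancels the 1/x of u_xx. What is left is the reduced
      equation with opposite sign, which \<open>neg\<close> absorbs.\<close>
    then have cancel: "x * a * (b / x) = a * b" for a b by simp
    have neg: "a = - b \<Longrightarrow> a = 0 \<longleftrightarrow> b = 0" for a b :: real by simp
    show "2 * k0 * (pd1 w (?q t x y) - pd1 (pd1 w) (?q t x y) - y\<^sup>2 / x * pd2 (pd1 w) (?q t x y))
        - ((w (?q t x y) - pd1 w (?q t x y) - y\<^sup>2 / x * pd2 w (?q t x y))\<^sup>2 +
          x * w (?q t x y) * ((- pd1 w (?q t x y) + pd1 (pd1 w) (?q t x y)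
          + y\<^sup>2 / x * (2 * pd2 (pd1 w) (?q t x y) + y\<^sup>2 / x * pd2 (pd2 w) (?q t x y))) / x))
        - (2 * pd2 w (?q t x y) + 4 * (y\<^sup>2 / x) * pd2 (pd2 w) (?q t x y)) = 0 \<longleftrightarrow>
      (case (case (t, x, y) of (t, x, y) \<Rightarrow> ?q t x y) of (r, z) \<Rightarrow>
        2 * pd2 w (r, z) + (- w (r, z) + pd1 w (r, z) + z * pd2 w (r, z))\<^sup>2
        + 2 * k0 * (pd1 (pd1 w) (r, z) + z * pd2 (pd1 w) (r, z))
        + 4 * z * pd2 (pd2 w) (r, z)
        + w (r, z) * (- pd1 w (r, z) + pd1 (pd1 w) (r, z)
            + z * (2 * pd2 (pd1 w) (r, z) + z * pd2 (pd2 w) (r, z)))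
        - 2 * k0 * pd1 w (r, z) = 0)"
      unfolding cancel prod.case
      by (rule neg) (simp add: algebra_simps power2_eq_square)
  qed
qed

text \<open>On an interval slice a vanishing derivative forces a constant: this is used first for
  w_y and then for w - y w_y. On a slice with gaps the constants could differ from piece to
  piece.\<close>

lemma pd2_pd2_zero_iff_affine:
  assumes "\<forall>t. is_interval {y. (t, y) \<in> W}"
  shows "(\<forall>(t, y) \<in> W. pd2 (pd2 w) (t, y) = 0) \<longleftrightarrow>
    (\<exists>q1 q2 :: real \<Rightarrow> real. smooth_on (fst ` W) q1 \<and> smooth_on (fst ` W) q2 \<and>
      (\<forall>(t, y) \<in> W. w (t, y) = q1 t * y + q2 t))"
proof
  assume zero: "\<forall>(t, y) \<in> W. pd2 (pd2 w) (t, y) = 0"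
  \<comment> \<open>An arbitrary choice of y for each t, with no regularity in t; by constancy along
    the slice, \<open>q1\<close> and \<open>q2\<close> may be read off at any other y as
    well.\<close>
  define Y where "Y t = (SOME y. (t, y) \<in> W)" for t
  have Y: "(t, Y t) \<in> W" if "(t, y) \<in> W" for t y
    unfolding Y_def by (rule someI[of _ y]) (rule that)
  define q1 where "q1 t = pd2 w (t, Y t)" for t
  define q2 where "q2 t = w (t, Y t) - q1 t * Y t" for t
  have conv: "convex {y. (t, y) \<in> W}" for t
    using assms is_interval_convex by blast
  have q1: "pd2 w (t, y) = q1 t" if "(t, y) \<in> W" for t y
  proof -
    have "\<exists>c. \<forall>s\<in>{y. (t, y) \<in> W}. pd2 w (t, s) = c"
    proof (rule has_field_derivative_zero_constant[OF conv])
      fix s assume "s \<in> {y. (t, y) \<in> W}"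
      then have "((\<lambda>s. pd2 w (t, s)) has_real_derivative 0) (at s)"
        using DERIV_pd(2)[OF smooth_on_pd(2)[OF W w], of t s] zero by auto
      then show "((\<lambda>s. pd2 w (t, s)) has_real_derivative 0) (at s within {y. (t, y) \<in> W})"
        by (rule has_field_derivative_at_within)
    qed
    then show ?thesis using that Y[OF that] by (auto simp: q1_def)
  qed
  have q2: "w (t, y) = q1 t * y + q2 t" if "(t, y) \<in> W" for t y
  proof -
    have "\<exists>c. \<forall>s\<in>{y. (t, y) \<in> W}. w (t, s) - q1 t * s = c"
    proof (rule has_field_derivative_zero_constant[OF conv])
      fix s assume "s \<in> {y. (t, y) \<in> W}"
      then have "((\<lambda>s. w (t, s) - q1 t * s) has_real_derivative 0) (at s)"
        by (auto intro!: derivative_eq_intros DERIV_w simp: q1)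
      then show "((\<lambda>s. w (t, s) - q1 t * s) has_real_derivative 0) (at s within {y. (t, y) \<in> W})"
        by (rule has_field_derivative_at_within)
    qed
    then obtain c where "\<And>s. (t, s) \<in> W \<Longrightarrow> w (t, s) - q1 t * s = c" by auto
    from this[OF that] this[OF Y[OF that]] show ?thesis by (simp add: q2_def)
  qed
  have "\<exists>U. open U \<and> t \<in> U \<and> smooth_on U q1 \<and> smooth_on U q2" if t: "t \<in> fst ` W" for t
  proof -
    obtain y where y: "(t, y) \<in> W" using t by auto
    \<comment> \<open>With y fixed, this is an open neighbourhood of t on which \<open>q1\<close> is
      the smooth function w_y(s, y) and \<open>q2\<close> is w(s, y) - y \<open>q1\<close>.\<close>
    let ?U = "(\<lambda>s. (s, y)) -` W"
    have U: "open ?U"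
      by (rule open_vimage[OF W]) (auto intro: continuous_intros)
    have aff: "((\<lambda>s. (s, y)) has_derivative (\<lambda>h. (h, 0))) (at s)" for s
      by (auto intro!: derivative_eq_intros)
    have 1: "smooth_on ?U q1"
      by (rule smooth_on_cong[OF U smooth_on_compose_affine[OF U W aff _ smooth_on_pd(2)[OF W w]]])
        (auto simp: q1)
    have "smooth_on ?U (\<lambda>s. w (s, y) + - y * q1 s)"
      by (intro smooth_on_add smooth_on_mult smooth_on_const 1 U smooth_on_compose_affine[OF U W aff _ w]) auto
    then have "smooth_on ?U q2"
      by (rule smooth_on_cong[OF U]) (auto simp: q2)
    then show ?thesis using 1 U y by blast
  qed
  note loc = this
  have "smooth_on (fst ` W) q1"
    by (rule smooth_on_local) (use loc in blast)
  moreover have "smooth_on (fst ` W) q2"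
    by (rule smooth_on_local) (use loc in blast)
  ultimately show "\<exists>q1 q2. smooth_on (fst ` W) q1 \<and> smooth_on (fst ` W) q2 \<and>
      (\<forall>(t, y) \<in> W. w (t, y) = q1 t * y + q2 t)"
    using q2 by blast
next
  assume "\<exists>q1 q2. smooth_on (fst ` W) q1 \<and> smooth_on (fst ` W) q2 \<and>
      (\<forall>(t, y) \<in> W. w (t, y) = q1 t * y + q2 t)"
  then obtain q1 q2 where q: "\<And>t y. (t, y) \<in> W \<Longrightarrow> w (t, y) = q1 t * y + q2 t" by blast
  \<comment> \<open>The affine form holds only on \<open>W\<close>, but \<open>W\<close> is open, so
    it may be differentiated there.\<close>
  have "pd2 w (t, y) = q1 t" if "(t, y) \<in> W" for t y
    by (rule pd2_eqI[where F = "\<lambda>t y. q1 t * y + q2 t", OF W that q]) (auto intro!: derivative_eq_intros)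
  then have "pd2 (pd2 w) (t, y) = 0" if "(t, y) \<in> W" for t y
    by (rule pd2_eqI[where F = "\<lambda>t y. q1 t", OF W that]) auto
  then show "\<forall>(t, y) \<in> W. pd2 (pd2 w) (t, y) = 0" by blast
qed

end

text \<open>The explicit solution family for arbitrary smooth coefficients: both are composed with
  the first projection, and one is multiplied by the linear second projection.\<close>

lemma affine_solution:
  fixes T :: "real set" and q1 q2 :: "real \<Rightarrow> real"
  assumes "open T" "smooth_on T q1" "smooth_on T q2"
  shows "smooth_on (T \<times> UNIV) (\<lambda>(t, y). q1 t * y + q2 t)"
    and "pd2 (pd2 (\<lambda>(t, y). q1 t * y + q2 t)) (t, y) = 0"
proof -
  have S: "open (T \<times> (UNIV :: real set))"
    using assms(1) by (simp add: open_Times)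
  have fst': "(fst has_derivative fst) (at p)" for p :: "real \<times> real"
    by (rule bounded_linear_imp_has_derivative[OF bounded_linear_fst])
  have "smooth_on (T \<times> UNIV) (\<lambda>p :: real \<times> real. q1 (fst p) * snd p + q2 (fst p))"
    by (intro smooth_on_add smooth_on_mult S smooth_on_bounded_linear[OF bounded_linear_snd]
        smooth_on_compose_affine[OF S assms(1) fst'] assms(2,3)) auto
  then show "smooth_on (T \<times> UNIV) (\<lambda>(t, y). q1 t * y + q2 t)"
    by (simp add: split_beta')
  have pd2: "pd2 (\<lambda>(t, y). q1 t * y + q2 t) (t, y) = q1 t" for t y
    by (rule pd2_eqI[OF open_UNIV, where F = "\<lambda>t y. q1 t * y + q2 t"])
      (auto intro!: derivative_eq_intros)
  show "pd2 (pd2 (\<lambda>(t, y). q1 t * y + q2 t)) (t, y) = 0"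
    by (rule pd2_eqI[OF open_UNIV, where F = "\<lambda>t y. q1 t"]) (simp_all add: pd2)
qed

theorem mainTheorem3:
  fixes \<Omega> :: "(real \<times> real \<times> real) set" and u :: "real \<times> real \<times> real \<Rightarrow> real"
    and W :: "(real \<times> real) set" and w :: "real \<times> real \<Rightarrow> real"
    and k0 :: real
  assumes "open \<Omega>" and "smooth_on \<Omega> u"
    and "open W" and "smooth_on W w"
  shows
    "((\<forall>(t, x, y) \<in> \<Omega>. (t, y) \<in> W \<and> u (t, x, y) = w (t, y)) \<longrightarrow>
        invariant_on \<Omega> x1 u \<and>
        (solves_ZK_on \<Omega> u \<longleftrightarrow>
          (\<forall>(t, y) \<in> (\<lambda>(t, x, y). (t, y)) ` \<Omega>. pd2 (pd2 w) (t, y) = 0)))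
     \<and>
     ((\<forall>t. is_interval {y. (t, y) \<in> W}) \<longrightarrow>
        ((\<forall>(t, y) \<in> W. pd2 (pd2 w) (t, y) = 0) \<longleftrightarrow>
         (\<exists>q1 q2 :: real \<Rightarrow> real. smooth_on (fst ` W) q1 \<and> smooth_on (fst ` W) q2 \<and>
            (\<forall>(t, y) \<in> W. w (t, y) = q1 t * y + q2 t))))
     \<and>
     (\<forall>(T :: real set) (q1 :: real \<Rightarrow> real) (q2 :: real \<Rightarrow> real).
        open T \<and> smooth_on T q1 \<and> smooth_on T q2 \<longrightarrow>
        smooth_on (T \<times> UNIV) (\<lambda>(t, y). q1 t * y + q2 t) \<and>
        (\<forall>(t, y) \<in> T \<times> UNIV. pd2 (pd2 (\<lambda>(t, y). q1 t * y + q2 t)) (t, y) = 0))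
     \<and>
     ((\<forall>(t, x, y) \<in> \<Omega>. (t, x) \<in> W \<and> u (t, x, y) = w (t, x)) \<longrightarrow>
        invariant_on \<Omega> y1 u \<and>
        (solves_ZK_on \<Omega> u \<longleftrightarrow>
          (\<forall>(t, x) \<in> (\<lambda>(t, x, y). (t, x)) ` \<Omega>.
             - (pd2 w (t, x))\<^sup>2 + pd1 (pd2 w) (t, x) - w (t, x) * pd2 (pd2 w) (t, x) = 0)))
     \<and>
     ((\<forall>(t, x, y) \<in> \<Omega>. x \<noteq> 0 \<and> (t, y\<^sup>2 / x) \<in> W \<and> u (t, x, y) = x * w (t, y\<^sup>2 / x)) \<longrightarrow>
        invariant_on \<Omega> v0 u \<and>
        (solves_ZK_on \<Omega> u \<longleftrightarrow>
          (\<forall>(r, z) \<in> (\<lambda>(t, x, y). (t, y\<^sup>2 / x)) ` \<Omega>.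
             pd1 w (r, z) - 2 * pd2 w (r, z) - (w (r, z) - z * pd2 w (r, z))\<^sup>2
             - z * pd2 (pd1 w) (r, z) - 4 * z * pd2 (pd2 w) (r, z)
             - z\<^sup>2 * w (r, z) * pd2 (pd2 w) (r, z) = 0)))
     \<and>
     ((\<forall>(t, x, y) \<in> \<Omega>. x > 0 \<and> (2 * k0 * t - ln x, y\<^sup>2 / x) \<in> W \<and>
                       u (t, x, y) = x * w (2 * k0 * t - ln x, y\<^sup>2 / x)) \<longrightarrow>
        invariant_on \<Omega> (\<lambda>p. k0 *\<^sub>R v0 p + z1 p) u \<and>
        (solves_ZK_on \<Omega> u \<longleftrightarrow>
          (\<forall>(r, z) \<in> (\<lambda>(t, x, y). (2 * k0 * t - ln x, y\<^sup>2 / x)) ` \<Omega>.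
             2 * pd2 w (r, z) + (- w (r, z) + pd1 w (r, z) + z * pd2 w (r, z))\<^sup>2
             + 2 * k0 * (pd1 (pd1 w) (r, z) + z * pd2 (pd1 w) (r, z))
             + 4 * z * pd2 (pd2 w) (r, z)
             + w (r, z) * (- pd1 w (r, z) + pd1 (pd1 w) (r, z)
                 + z * (2 * pd2 (pd1 w) (r, z) + z * pd2 (pd2 w) (r, z)))
             - 2 * k0 * pd1 w (r, z) = 0)))
     \<and>
     ((\<forall>(t, x, y) \<in> \<Omega>. (x, y) \<in> W \<and> u (t, x, y) = w (x, y)) \<longrightarrow>
        invariant_on \<Omega> z1 u \<and>
        (solves_ZK_on \<Omega> u \<longleftrightarrow>
          (\<forall>(x, y) \<in> (\<lambda>(t, x, y). (x, y)) ` \<Omega>.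
             (pd1 w (x, y))\<^sup>2 + w (x, y) * pd1 (pd1 w) (x, y) + pd2 (pd2 w) (x, y) = 0)))"
\<comment> \<open>Thirteen goals arise: invariance and equivalence for each of the five forms of u,
  and three about the solutions of u_yy = 0.\<close>
proof (intro conjI impI allI, goal_cases)
  case 1
  then show ?case by (intro reduction_x1(1)[OF assms]) auto
next
  case 2
  then show ?case by (intro reduction_x1(2)[OF assms]) auto
next
  case 3
  then show ?case by (rule pd2_pd2_zero_iff_affine[OF assms])
next
  case (4 T q1 q2)
  then show ?case by (intro affine_solution(1)) auto
next
  case (5 T q1 q2)
  then show ?case using affine_solution(2)[of T q1 q2] by blast
next
  case 6
  then show ?case by (intro reduction_y1(1)[OF assms]) auto
next
  case 7
  then show ?case by (intro reduction_y1(2)[OF assms]) auto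
next
  case 8
  then show ?case by (intro reduction_v0(1)[OF assms]) auto
next
  case 9
  then show ?case by (intro reduction_v0(2)[OF assms]) auto
next
  case 10
  then show ?case by (intro reduction_v0_z1(1)[OF assms]) auto
next
  case 11
  then show ?case by (intro reduction_v0_z1(2)[OF assms]) auto
next
  case 12
  then show ?case by (intro reduction_z1(1)[OF assms]) auto
next
  case 13
  then show ?case by (intro reduction_z1(2)[OF assms]) auto
qed

end
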